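(* Let $\{(\boldsymbol X(t),V(t)),t\ge 0\}$ be the cyclic random motion in $\mathbb R^3$ with directions $\vec v_1,\vec v_2,\vec v_3,\vec v_4$, speed $c>0$ and durations $D_{j,k}$ described in the context, started from the origin with initial direction $\vec v_1$, and let $\mathbb P_1$ be the corresponding probability. Then for every $t\ge 0$ $$\mathbb P_1\{\boldsymbol X(t)=(ct\cos\theta_1\sin\varphi_1,\;ct\sin\theta_1\sin\varphi_1,\;ct\cos\varphi_1),\ V(t)=\vec v_1\}=\mathbb P\{D_{1,1}>t\},$$ $$\mathbb P_1\{\boldsymbol X(t)\in E_{12}(t),\ V(t)=\vec v_2\}=\mathbb P\{D_{1,1}<t\le D_{1,1}+D_{2,1}\},$$ $$\mathbb P_1\{\boldsymbol X(t)\in F_{123}(t),\ V(t)=\vec v_3\}=\mathbb P\{D_{1,1}+D_{2,1}<t\le D_{1,1}+D_{2,1}+D_{3,1}\}.$$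
   Context: Directions. For $1\le j\le 4$ let $\vec v_j=(\cos\theta_j\sin\varphi_j,\ \sin\theta_j\sin\varphi_j,\ \cos\varphi_j)$ with $\theta_j\in[0,2\pi]$, $\varphi_j\in[0,\pi]$, be unit vectors of $\mathbb R^3$ that are affinely independent, so that for $t>0$ the points $A_j(t)=ct\,\vec v_j$ are the vertices of a non-degenerate tetrahedron $\mathcal T(t)$ (the convex hull of $A_1(t),\dots,A_4(t)$). $E_{12}(t)$ is the edge (closed segment) joining $A_1(t)$ and $A_2(t)$; $F_{123}(t)$ is the face (closed triangle) with vertices $A_1(t),A_2(t),A_3(t)$. Durations. For each $j\in\{1,2,3,4\}$, $(D_{j,k})_{k\ge1}$ is the sequence of interarrival times of a geometric counting process (GCP) with intensity $\lambda_j>0$: a mixed Poisson process whose random intensity $\alpha_j$ is exponentially distributed with mean $\lambda_j$ (given $\alpha_j$, the $D_{j,k}$, $k\ge 1$, are i.i.d. exponential with rate $\alpha_j$). The four sequences $(D_{j,k})_{k\ge 1}$, $1\le j\le 4$, are mutually independent. Put $D_j^{(0)}=0$, $D_j^{(k)}=\sum_{i=1}^kD_{j,i}$. Motion. The particle starts at the origin at time $0$ with direction $\vec v_1$ and takes directions cyclically $\vec v_1\to\vec v_2\to\vec v_3\to\vec v_4\to\vec v_1\to\cdots$; during the $k$-th cycle it moves along $\vec v_j$ for a time $D_{j,k}$. Thus the switching times are $T_0=0$ and $T_{4n+j}=\sum_{r=1}^{j}D_r^{(n+1)}+\sum_{r=j+1}^{4}D_r^{(n)}$ for $n\ge0$,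 $1\le j\le4$; $V(t)=\vec v_j$ for $T_{4n+j-1}\le t<T_{4n+j}$; and $\boldsymbol X(t)=c\int_0^tV(s)\,ds$. $\mathbb P_1$ denotes probability conditional on $\{\boldsymbol X(0)=\boldsymbol 0, V(0)=\vec v_1\}$. *)

theory Defs
  imports "HOL-Probability.Probability"
begin

definition direction :: "(nat \<Rightarrow> real) \<Rightarrow> (nat \<Rightarrow> real) \<Rightarrow> nat \<Rightarrow> real ^ 3" where
  "direction \<theta> \<phi> j = vector [cos (\<theta> j) * sin (\<phi> j), sin (\<theta> j) * sin (\<phi> j), cos (\<phi> j)]"

definition vertex :: "real \<Rightarrow> (nat \<Rightarrow> real ^ 3) \<Rightarrow> real \<Rightarrow> nat \<Rightarrow> real ^ 3" where
  "vertex c v t j = (c * t) *\<^sub>R v j"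

definition edge12 :: "real \<Rightarrow> (nat \<Rightarrow> real ^ 3) \<Rightarrow> real \<Rightarrow> (real ^ 3) set" where
  "edge12 c v t = closed_segment (vertex c v t 1) (vertex c v t 2)"

definition face123 :: "real \<Rightarrow> (nat \<Rightarrow> real ^ 3) \<Rightarrow> real \<Rightarrow> (real ^ 3) set" where
  "face123 c v t = convex hull {vertex c v t 1, vertex c v t 2, vertex c v t 3}"

text \<open>Interarrival times \<open>W 1, W 2, \<dots>\<close> of a mixed Poisson process with random intensity \<open>\<alpha>\<close>:
  conditionally on (the sigma-algebra generated by) \<open>\<alpha>\<close> they are i.i.d. exponential with rate \<open>\<alpha>\<close>.
  The value \<open>W 0\<close> plays no role.\<close>

definition mixed_poisson_interarrivals ::
    "'w measure \<Rightarrow> ('w \<Rightarrow> real) \<Rightarrow> (nat \<Rightarrow> 'w \<Rightarrow> real) \<Rightarrow> bool" where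
  "mixed_poisson_interarrivals M \<alpha> W \<longleftrightarrow>
     \<alpha> \<in> borel_measurable M \<and> (\<forall>k\<ge>1. W k \<in> borel_measurable M) \<and>
     (\<forall>n A. (\<forall>k. A k \<in> sets borel) \<longrightarrow>
       (AE \<omega> in M.
          real_cond_exp M (vimage_algebra (space M) \<alpha> borel)
            (indicator {\<omega> \<in> space M. \<forall>k\<in>{1..n}. W k \<omega> \<in> A k}) \<omega> =
          (\<Prod>k=1..n. measure (density lborel (\<lambda>x. ennreal (exponential_density (\<alpha> \<omega>) x))) (A k))))"

text \<open>Geometric counting process of intensity \<open>l\<close>: the mixing variable is exponential with
  mean \<open>l\<close>, i.e. with rate \<open>1 / l\<close>.\<close>

definition gcp_interarrivals :: "'w measure \<Rightarrow> real \<Rightarrow> (nat \<Rightarrow> 'w \<Rightarrow> real) \<Rightarrow> bool" where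
  "gcp_interarrivals M l W \<longleftrightarrow>
     (\<exists>\<alpha>. distributed M lborel \<alpha> (exponential_density (1 / l)) \<and> mixed_poisson_interarrivals M \<alpha> W)"

definition total_duration :: "(nat \<Rightarrow> nat \<Rightarrow> 'w \<Rightarrow> real) \<Rightarrow> nat \<Rightarrow> nat \<Rightarrow> 'w \<Rightarrow> real" where
  "total_duration D j k \<omega> = (\<Sum>i=1..k. D j i \<omega>)"

text \<open>The quotient and remainder modulo 4 put \<open>m = 4 * n + 4\<close> in the block \<open>n + 1\<close> with remainder 0;
  \<open>switch_time_0\<close> and \<open>switch_time_block\<close> give the indexing by \<open>1 \<le> j \<le> 4\<close>.\<close>

definition switch_time :: "(nat \<Rightarrow> nat \<Rightarrow> 'w \<Rightarrow> real) \<Rightarrow> nat \<Rightarrow> 'w \<Rightarrow> real" where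
  "switch_time D m \<omega> =
     (\<Sum>r=1..m mod 4. total_duration D r (m div 4 + 1) \<omega>) +
     (\<Sum>r=m mod 4 + 1..4. total_duration D r (m div 4) \<omega>)"

lemma switch_time_0: "switch_time D 0 \<omega> = 0"
  by (simp add: switch_time_def total_duration_def)

lemma switch_time_block:
  assumes "1 \<le> j" "j \<le> 4"
  shows "switch_time D (4 * n + j) \<omega> =
     (\<Sum>r=1..j. total_duration D r (n + 1) \<omega>) + (\<Sum>r=j+1..4. total_duration D r n \<omega>)"
proof (cases "j = 4")
  case True
  then have "(4 * n + j) div 4 = n + 1" "(4 * n + j) mod 4 = 0" by auto
  then show ?thesis using True by (simp add: switch_time_def)
next
  case False
  then have "(4 * n + j) div 4 = n" "(4 * n + j) mod 4 = j" using assms by auto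
  then show ?thesis by (simp add: switch_time_def)
qed

text \<open>On \<open>[T m, T (m + 1))\<close> with \<open>m = 4 * n + j - 1\<close> the velocity is \<open>v j\<close>, and \<open>j = m mod 4 + 1\<close>.
  Almost surely all durations are positive and the switching times tend to infinity, so that
  every \<open>t \<ge> 0\<close> lies in exactly one of these intervals; on the remaining null set the choice of the
  least \<open>m\<close>, or of the value 0 if there is none, is a mere convention.\<close>

definition velocity ::
    "(nat \<Rightarrow> real ^ 3) \<Rightarrow> (nat \<Rightarrow> nat \<Rightarrow> 'w \<Rightarrow> real) \<Rightarrow> real \<Rightarrow> 'w \<Rightarrow> real ^ 3" where
  "velocity v D t \<omega> =
     (if \<exists>m. switch_time D m \<omega> \<le> t \<and> t < switch_time D (m + 1) \<omega>
      then v ((LEAST m. switch_time D m \<omega> \<le> t \<and> t < switch_time D (m + 1) \<omega>) mod 4 + 1)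
      else 0)"

definition position ::
    "real \<Rightarrow> (nat \<Rightarrow> real ^ 3) \<Rightarrow> (nat \<Rightarrow> nat \<Rightarrow> 'w \<Rightarrow> real) \<Rightarrow> real \<Rightarrow> 'w \<Rightarrow> real ^ 3" where
  "position c v D t \<omega> = c *\<^sub>R (LBINT s:{0..t}. velocity v D s \<omega>)"

lemma switch_time_Suc:
  "switch_time D (Suc m) \<omega> = switch_time D m \<omega> + D (m mod 4 + 1) (m div 4 + 1) \<omega>"
proof -
  define n j where "n = m div 4" and "j = m mod 4 + 1"
  have j: "1 \<le> j" "j \<le> 4" and m: "Suc m = 4 * n + j"
    unfolding n_def j_def by (auto simp: Suc_le_eq)
  let ?f = "\<lambda>r k. total_duration D r k \<omega>"
  have "{1..j} = insert j {1..j - 1}" using j by auto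
  then have 1: "(\<Sum>r=1..j. ?f r (n + 1)) = ?f j (n + 1) + (\<Sum>r=1..j - 1. ?f r (n + 1))"
    using j by simp
  have "{j..4} = insert j {j + 1..4}" using j by auto
  then have 2: "(\<Sum>r=j..4. ?f r n) = ?f j n + (\<Sum>r=j + 1..4. ?f r n)"
    by simp
  have 3: "?f j (n + 1) = ?f j n + D j (n + 1) \<omega>"
    by (simp add: total_duration_def)
  have 4: "switch_time D m \<omega> = (\<Sum>r=1..j - 1. ?f r (n + 1)) + (\<Sum>r=j..4. ?f r n)"
    unfolding switch_time_def n_def j_def by simp
  have "switch_time D (Suc m) \<omega> = switch_time D m \<omega> + D j (n + 1) \<omega>"
    unfolding m switch_time_block[OF j] 4 1 2 3 by simp
  then show ?thesis by (simp only: n_def j_def)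
qed

lemma velocity_eq:
  assumes pos: "\<And>j k. j \<in> {1..4} \<Longrightarrow> k \<ge> 1 \<Longrightarrow> D j k \<omega> > 0"
    and j: "j \<in> {1..4}"
    and t: "switch_time D (4 * n + j - 1) \<omega> \<le> t" "t < switch_time D (4 * n + j) \<omega>"
  shows "velocity v D t \<omega> = v j"
proof -
  define m where "m = 4 * n + j - 1"
  obtain i where i: "j = Suc i" "i < 4" using j by (cases j) auto
  have m1: "m + 1 = 4 * n + j" "m mod 4 + 1 = j" using i unfolding m_def by simp_all
  have "switch_time D i \<omega> < switch_time D (Suc i) \<omega>" for i
    unfolding switch_time_Suc by (simp add: pos)
  then have "strict_mono (\<lambda>i. switch_time D i \<omega>)" by (simp add: strict_mono_Suc_iff)
  then have mono: "switch_time D i \<omega> \<le> switch_time D i' \<omega>" if "i \<le> i'" for i i'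
    using strict_mono_mono[THEN monoD] that by fast
  have P: "switch_time D m \<omega> \<le> t \<and> t < switch_time D (m + 1) \<omega>"
    using t m1 m_def by simp
  have "(LEAST i. switch_time D i \<omega> \<le> t \<and> t < switch_time D (i + 1) \<omega>) = m"
  proof (rule Least_equality)
    show "switch_time D m \<omega> \<le> t \<and> t < switch_time D (m + 1) \<omega>" by (rule P)
  next
    fix i assume i: "switch_time D i \<omega> \<le> t \<and> t < switch_time D (i + 1) \<omega>"
    show "m \<le> i"
      using mono[of "i + 1" m] i P by (cases "i + 1 \<le> m") auto
  qed
  then show ?thesis using P m1 by (auto simp: velocity_def)
qed

end

theory Submission imports Defs begin

text \<open>Write \<open>T m\<close> for the switching times. All three claims say that a particle which at time \<open>t\<close>
  moves along \<open>v k\<close> with \<open>k < 4\<close>, and lies on the face of the simplex spanned by the first \<open>k\<close>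
  vertices, is still in its first cycle, so that \<open>T (k - 1) \<le> t < T k\<close>. The reason is affine
  independence. The position at time \<open>t\<close> is \<open>c\<close> times the sum of the \<open>v j\<close> weighted by the
  occupation times, i.e. the amounts of time spent in each direction up to \<open>t\<close>; these are
  nonnegative and add up to \<open>t\<close>, hence they are \<open>t\<close> times barycentric coordinates with respect to the
  vertices. Lying on the face forces the occupation time of direction \<open>k + 1\<close> to vanish, whereas a
  particle moving along \<open>v k\<close> in a later cycle has already completed a movement of positive
  duration along \<open>v (k + 1)\<close>. Conversely, before \<open>T k\<close> only the first \<open>k\<close> directions have been used.
  This equivalence, \<open>position_in_leading_face_iff\<close>, holds path by path whenever all durations are
  positive. It concerns only what happens before \<open>t\<close>, so an accumulation of the switching times is
  harmless: at or after an accumulation point the velocity is 0, which is none of the \<open>v k\<close>.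

  What remains is probabilistic. Almost surely all durations are positive, because an exponential
  law of any rate gives no mass to the nonpositive numbers; therefore the conditioning
  event has probability 1 (\<open>cond_prob_leading_face\<close>; the measurability needed there comes from
  that of the velocity jointly in time and outcome, by Fubini). The right-hand sides of the claims have
  \<open>T (k - 1) < t \<le> T k\<close> for \<open>k = 2, 3\<close>, which differs from the above by the events \<open>T k = t\<close> and
  \<open>T (k - 1) = t\<close>. These are null, since each duration is atomless and a sum of two independent
  variables is atomless as soon as one of them is (\<open>AE_indep_add_neq\<close>).\<close>

section \<open>Affine independence\<close>

lemma affine_independent_family_weights_zero:
  fixes v :: "'i \<Rightarrow> 'a::real_vector"
  assumes "finite I" "inj_on v I" "\<not> affine_dependent (v ` I)"
    and "(\<Sum>i\<in>I. u i) = 0" "(\<Sum>i\<in>I. u i *\<^sub>R v i) = 0" "i \<in> I"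
  shows "u i = 0"
proof (rule ccontr)
  assume "u i \<noteq> 0"
  let ?u = "u \<circ> inv_into I v"
  have inv: "inv_into I v (v j) = j" if "j \<in> I" for j
    using assms(2) that by (rule inv_into_f_f)
  have "sum ?u (v ` I) = 0" "(\<Sum>x\<in>v ` I. ?u x *\<^sub>R x) = 0"
    using assms(4,5) inv by (simp_all add: sum.reindex[OF assms(2)])
  moreover have "\<exists>x\<in>v ` I. ?u x \<noteq> 0"
    using \<open>u i \<noteq> 0\<close> inv \<open>i \<in> I\<close> by auto
  ultimately have "affine_dependent (v ` I)"
    using assms(1) by (auto simp: affine_dependent_explicit_finite)
  then show False using assms(3) by simp
qed

lemma convex_hull_image_weights:
  fixes v :: "'i \<Rightarrow> 'a::real_vector"
  assumes "finite S" "inj_on v S" "x \<in> convex hull (v ` S)"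
  obtains w where "\<And>i. i \<in> S \<Longrightarrow> 0 \<le> w i" "(\<Sum>i\<in>S. w i) = (1::real)"
    "x = (\<Sum>i\<in>S. w i *\<^sub>R v i)"
proof -
  obtain u where u: "\<forall>y\<in>v ` S. 0 \<le> u y" "sum u (v ` S) = 1" "(\<Sum>y\<in>v ` S. u y *\<^sub>R y) = x"
    using assms by (auto simp: convex_hull_finite)
  show ?thesis
    by (rule that[of "u \<circ> v"]) (use u in \<open>auto simp: sum.reindex[OF assms(2)]\<close>)
qed

text \<open>A point of the face has convex coordinates supported on \<open>S\<close>, and barycentric coordinates are
  unique: the difference of the two systems of weights is an affine dependence.\<close>

lemma barycentric_weight_zero_outside_face:
  fixes v :: "'i \<Rightarrow> 'a::real_vector"
  assumes "finite I" "inj_on v I" "\<not> affine_dependent (v ` I)"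
    and "S \<subseteq> I" "(\<Sum>i\<in>I. w i) = (1::real)" "(\<Sum>i\<in>I. w i *\<^sub>R v i) \<in> convex hull (v ` S)"
    and "i \<in> I - S"
  shows "w i = 0"
proof -
  have "finite S" "inj_on v S" using assms finite_subset inj_on_subset by blast+
  then obtain w' where w': "(\<Sum>i\<in>S. w' i) = (1::real)"
      "(\<Sum>i\<in>I. w i *\<^sub>R v i) = (\<Sum>i\<in>S. w' i *\<^sub>R v i)"
    using convex_hull_image_weights[OF _ _ assms(6)] by metis
  define u where "u j = w j - (if j \<in> S then w' j else 0)" for j
  have IS: "I \<inter> S = S" using assms(4) by auto
  have "(\<Sum>j\<in>I. u j) = 0"
    using w'(1) assms(1,5) IS by (simp add: u_def sum_subtractf sum.If_cases Int_commute)
  moreover have "(\<Sum>j\<in>I. u j *\<^sub>R v j)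
      = (\<Sum>j\<in>I. w j *\<^sub>R v j) - (\<Sum>j\<in>I. if j \<in> S then w' j *\<^sub>R v j else 0)"
    unfolding sum_subtractf[symmetric]
    by (rule sum.cong) (auto simp: u_def scaleR_diff_left)
  then have "(\<Sum>j\<in>I. u j *\<^sub>R v j) = 0"
    using w'(2) assms(1) IS by (simp add: sum.If_cases Int_commute)
  ultimately have "u i = 0"
    using affine_independent_family_weights_zero[OF assms(1-3)] assms(7) by blast
  then show ?thesis using assms(7) by (simp add: u_def)
qed

section \<open>Paths of the motion\<close>

text \<open>The index of the movement in progress at time \<open>s\<close>; it determines the direction as
  \<open>phase mod 4 + 1\<close>. If no movement is in progress its value is arbitrary, but still measurable
  in \<open>s\<close>, and the occupation times then still add up to \<open>t\<close>.\<close>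

definition phase :: "(nat \<Rightarrow> nat \<Rightarrow> 'w \<Rightarrow> real) \<Rightarrow> real \<Rightarrow> 'w \<Rightarrow> nat" where
  "phase D s \<omega> = (LEAST m. switch_time D m \<omega> \<le> s \<and> s < switch_time D (m + 1) \<omega>)"

definition occupation_time :: "(nat \<Rightarrow> nat \<Rightarrow> 'w \<Rightarrow> real) \<Rightarrow> real \<Rightarrow> 'w \<Rightarrow> nat \<Rightarrow> real" where
  "occupation_time D t \<omega> j = measure lborel {s \<in> {0..t}. phase D s \<omega> mod 4 + 1 = j}"

lemma velocity_phase:
  "velocity v D s \<omega> =
     (if \<exists>m. switch_time D m \<omega> \<le> s \<and> s < switch_time D (m + 1) \<omega>
      then v (phase D s \<omega> mod 4 + 1) else 0)"
  unfolding velocity_def phase_def ..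

lemma strict_mono_switch_time:
  assumes "\<And>j k. j \<in> {1..4} \<Longrightarrow> k \<ge> 1 \<Longrightarrow> D j k \<omega> > 0"
  shows "strict_mono (\<lambda>m. switch_time D m \<omega>)"
  by (simp add: strict_mono_Suc_iff switch_time_Suc assms)

lemma phase_eqI:
  assumes "strict_mono (\<lambda>m. switch_time D m \<omega>)"
    and "switch_time D m \<omega> \<le> s" "s < switch_time D (m + 1) \<omega>"
  shows "phase D s \<omega> = m"
  unfolding phase_def
proof (rule Least_equality)
  fix i assume "switch_time D i \<omega> \<le> s \<and> s < switch_time D (i + 1) \<omega>"
  then have "switch_time D m \<omega> < switch_time D (i + 1) \<omega>" using assms by linarith
  then show "m \<le> i" using strict_mono_less[OF assms(1)] by auto
qed (use assms in simp)

text \<open>Only finitely many intervals lie before \<open>T m\<close>, so they cover all times from 0 up to \<open>T m\<close>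
  even if the switching times accumulate later.\<close>

lemma interval_before_switch_time:
  assumes "0 \<le> s" "s < switch_time D m \<omega>"
  obtains i where "i < m" "switch_time D i \<omega> \<le> s" "s < switch_time D (i + 1) \<omega>"
proof -
  have "\<exists>i<m. switch_time D i \<omega> \<le> s \<and> s < switch_time D (i + 1) \<omega>"
    using assms(2)
  proof (induction m)
    case 0
    then show ?case using assms(1) by (simp add: switch_time_0)
  next
    case (Suc m)
    then show ?case by (cases "s < switch_time D m \<omega>") (auto intro: less_SucI)
  qed
  then show ?thesis using that by blast
qed

lemma measurable_phase_time [measurable]:
  "(\<lambda>s. phase D s \<omega>) \<in> borel \<rightarrow>\<^sub>M count_space UNIV"
  unfolding phase_def by measurable

lemma sets_occupation [measurable]:
  "{s \<in> {0..t}. phase D s \<omega> mod 4 + 1 = j} \<in> sets borel"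
  by measurable

lemma fmeasurable_occupation:
  "{s \<in> {0..t}. phase D s \<omega> mod 4 + 1 = j} \<in> fmeasurable lborel"
proof (rule fmeasurableI2)
  show "{0..t} \<in> fmeasurable lborel" by (intro fmeasurableI) (auto simp: emeasure_lborel_Icc_eq)
qed auto

lemma sum_indicator_occupation:
  fixes f :: "nat \<Rightarrow> 'b::real_vector"
  shows "(\<Sum>j=1..4. indicator {s \<in> {0..t}. phase D s \<omega> mod 4 + 1 = j} s *\<^sub>R f j)
     = (indicator {0..t} s :: real) *\<^sub>R f (phase D s \<omega> mod 4 + 1)"
proof -
  have "(\<Sum>j=1..4. indicator {s \<in> {0..t}. phase D s \<omega> mod 4 + 1 = j} s *\<^sub>R f j)
     = (\<Sum>j=1..4. if j = phase D s \<omega> mod 4 + 1 then (indicator {0..t} s :: real) *\<^sub>R f j else 0)"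
    by (rule sum.cong) (auto simp: indicator_def)
  also have "\<dots> = (indicator {0..t} s :: real) *\<^sub>R f (phase D s \<omega> mod 4 + 1)"
    by (subst sum.delta) (auto simp: Suc_le_eq)
  finally show ?thesis .
qed

text \<open>Up to time \<open>t\<close> the integrand is a simple function taking the value \<open>f j\<close> while direction \<open>j\<close> is in
  use. For the directions it computes the position; for the constant 1 it gives the total time.\<close>

lemma integral_phase_eq_occupation:
  fixes f :: "nat \<Rightarrow> 'b::{banach, second_countable_topology}"
  shows "(LBINT s:{0..t}. f (phase D s \<omega> mod 4 + 1))
    = (\<Sum>j=1..4. occupation_time D t \<omega> j *\<^sub>R f j)"
proof -
  let ?A = "\<lambda>j. {s \<in> {0..t}. phase D s \<omega> mod 4 + 1 = j}"
  have int: "integrable lborel (indicator (?A j) :: real \<Rightarrow> real)" for j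
    using fmeasurable_occupation[of t D \<omega> j] by (simp add: fmeasurable_def)
  have "(LBINT s:{0..t}. f (phase D s \<omega> mod 4 + 1))
      = (LBINT s. (\<Sum>j=1..4. indicator (?A j) s *\<^sub>R f j))"
    unfolding set_lebesgue_integral_def sum_indicator_occupation ..
  also have "\<dots> = (\<Sum>j=1..4. LBINT s. indicator (?A j) s *\<^sub>R f j)"
    by (rule Bochner_Integration.integral_sum) (use int in auto)
  also have "\<dots> = (\<Sum>j=1..4. occupation_time D t \<omega> j *\<^sub>R f j)"
    by (rule sum.cong[OF refl], subst integral_scaleR_left)
       (use int in \<open>auto simp: occupation_time_def\<close>)
  finally show ?thesis .
qed

lemma occupation_time_nonneg: "0 \<le> occupation_time D t \<omega> j"
  by (simp add: occupation_time_def)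

lemma sum_occupation_time:
  assumes "0 \<le> t"
  shows "(\<Sum>j=1..4. occupation_time D t \<omega> j) = t"
  using integral_phase_eq_occupation[of t "\<lambda>_. 1::real" D \<omega>] assms
  by (simp add: set_lebesgue_integral_def)

lemma position_eq_occupation:
  assumes "t < switch_time D m \<omega>"
  shows "position c v D t \<omega> = c *\<^sub>R (\<Sum>j=1..4. occupation_time D t \<omega> j *\<^sub>R v j)"
proof -
  have "velocity v D s \<omega> = v (phase D s \<omega> mod 4 + 1)" if "s \<in> {0..t}" for s
  proof -
    have "0 \<le> s" "s < switch_time D m \<omega>" using that assms by auto
    then obtain i where "switch_time D i \<omega> \<le> s" "s < switch_time D (i + 1) \<omega>"
      by (rule interval_before_switch_time)
    then show ?thesis by (auto simp: velocity_phase)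
  qed
  then have "(LBINT s:{0..t}. velocity v D s \<omega>) = (LBINT s:{0..t}. v (phase D s \<omega> mod 4 + 1))"
    by (intro set_lebesgue_integral_cong) auto
  then show ?thesis
    by (simp only: position_def integral_phase_eq_occupation)
qed

text \<open>A completed movement contributes its whole positive duration to its direction.\<close>

lemma occupation_time_pos:
  assumes T: "strict_mono (\<lambda>m. switch_time D m \<omega>)" and "switch_time D (m + 1) \<omega> \<le> t"
  shows "0 < occupation_time D t \<omega> (m mod 4 + 1)"
proof -
  let ?I = "{switch_time D m \<omega>..<switch_time D (m + 1) \<omega>}"
  have lt: "switch_time D m \<omega> < switch_time D (m + 1) \<omega>" using strict_monoD[OF T] by simp
  have "0 \<le> switch_time D m \<omega>"
    using strict_mono_less_eq[OF T, of 0 m] by (simp add: switch_time_0)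
  then have "?I \<subseteq> {s \<in> {0..t}. phase D s \<omega> mod 4 + 1 = m mod 4 + 1}"
    using assms(2) phase_eqI[OF T] by auto
  then have "measure lborel ?I \<le> occupation_time D t \<omega> (m mod 4 + 1)"
    unfolding occupation_time_def by (intro measure_mono_fmeasurable fmeasurable_occupation) auto
  then show ?thesis using lt by simp
qed

lemma occupation_time_zero:
  assumes T: "strict_mono (\<lambda>m. switch_time D m \<omega>)" and "t < switch_time D k \<omega>" "k < j" "k \<le> 4"
  shows "occupation_time D t \<omega> j = 0"
proof -
  have "phase D s \<omega> mod 4 + 1 \<noteq> j" if "s \<in> {0..t}" for s
  proof -
    have "0 \<le> s" "s < switch_time D k \<omega>" using that assms by auto
    then obtain i where i: "i < k" "switch_time D i \<omega> \<le> s" "s < switch_time D (i + 1) \<omega>"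
      by (rule interval_before_switch_time)
    then show ?thesis using phase_eqI[OF T i(2,3)] assms by auto
  qed
  then have "{s \<in> {0..t}. phase D s \<omega> mod 4 + 1 = j} = {}" by auto
  then show ?thesis by (simp only: occupation_time_def measure_empty)
qed

lemma convex_hull_vertices:
  "convex hull (vertex c v t ` S) = (*\<^sub>R) (c * t) ` (convex hull (v ` S))"
proof -
  have "vertex c v t ` S = (*\<^sub>R) (c * t) ` (v ` S)"
    by (auto simp: vertex_def)
  then show ?thesis by (simp add: convex_hull_scaling)
qed

text \<open>The bound \<open>k < 4\<close> is essential: for \<open>k = 4\<close> the face is the whole tetrahedron, which contains the
  particle in every cycle. For \<open>k < 4\<close> there is a direction \<open>k + 1\<close> off the face, which
  enters between the first and the second movement along \<open>v k\<close>.\<close>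

lemma position_in_leading_face_iff:
  fixes v :: "nat \<Rightarrow> real ^ 3"
  assumes pos: "\<And>j k. j \<in> {1..4} \<Longrightarrow> k \<ge> 1 \<Longrightarrow> D j k \<omega> > 0"
    and v: "inj_on v {1..4}" "\<not> affine_dependent (v ` {1..4})" "0 \<notin> v ` {1..4}"
    and c: "c > 0" and t: "t \<ge> 0" and k: "1 \<le> k" "k < 4"
  shows "position c v D t \<omega> \<in> convex hull (vertex c v t ` {1..k}) \<and> velocity v D t \<omega> = v k
    \<longleftrightarrow> switch_time D (k - 1) \<omega> \<le> t \<and> t < switch_time D k \<omega>" (is "?L \<longleftrightarrow> ?R")
proof
  have T: "strict_mono (\<lambda>m. switch_time D m \<omega>)"
    using pos by (rule strict_mono_switch_time)
  let ?w = "occupation_time D t \<omega>"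
  assume L: ?L
  have "v k \<noteq> 0" using v(3) k by (metis atLeastAtMost_iff image_eqI less_imp_le)
  then obtain m where m: "switch_time D m \<omega> \<le> t" "t < switch_time D (m + 1) \<omega>"
    using L by (auto simp: velocity_phase split: if_splits)
  then have "v (m mod 4 + 1) = v k"
    using L m phase_eqI[OF T m] unfolding velocity_phase by metis
  then have mk: "m mod 4 + 1 = k"
    using k inj_onD[OF v(1)] by (auto simp: Suc_le_eq)
  \<comment> \<open>Past the first cycle, direction \<open>k + 1\<close> would have been used for a positive time.\<close>
  have "m < 4"
  proof (rule ccontr)
    assume "\<not> m < 4"
    then have "switch_time D (k + 1) \<omega> \<le> t"
      using strict_mono_less_eq[OF T, of "k + 1" m] m(1) k by simp
    then have w: "0 < ?w (k + 1)" using occupation_time_pos[OF T, of k] k by simp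
    have "0 < switch_time D (k + 1) \<omega>"
      using strict_mono_less[OF T, of 0 "k + 1"] by (simp add: switch_time_0)
    then have t: "0 < t" using \<open>switch_time D (k + 1) \<omega> \<le> t\<close> by simp
    obtain x where x: "x \<in> convex hull (v ` {1..k})" "position c v D t \<omega> = (c * t) *\<^sub>R x"
      using L by (auto simp: convex_hull_vertices)
    have "c *\<^sub>R (\<Sum>j=1..4. ?w j *\<^sub>R v j) = c *\<^sub>R (t *\<^sub>R x)"
      using x(2) position_eq_occupation[of t D "m + 1" \<omega> c v] m(2) by simp
    then have eq: "(\<Sum>j=1..4. ?w j *\<^sub>R v j) = t *\<^sub>R x"
      using c scaleR_cancel_left[of c] by (metis less_irrefl)
    have "(\<Sum>j=1..4. (?w j / t) *\<^sub>R v j) = (1 / t) *\<^sub>R (\<Sum>j=1..4. ?w j *\<^sub>R v j)"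
      by (simp add: scaleR_sum_right)
    also have "\<dots> = x" unfolding eq using t by simp
    finally have "(\<Sum>j=1..4. (?w j / t) *\<^sub>R v j) \<in> convex hull (v ` {1..k})" using x(1) by simp
    moreover have "(\<Sum>j=1..4. ?w j / t) = 1"
      using sum_occupation_time[of t D \<omega>] t by (simp flip: sum_divide_distrib)
    ultimately have "?w (k + 1) / t = 0"
      using k by (intro barycentric_weight_zero_outside_face[OF _ v(1,2), of "{1..k}"]) auto
    then show False using w t by simp
  qed
  then have "m + 1 = k" using mk by simp
  then show ?R using m by auto
next
  have T: "strict_mono (\<lambda>m. switch_time D m \<omega>)"
    using pos by (rule strict_mono_switch_time)
  let ?w = "occupation_time D t \<omega>"
  assume R: ?R
  then have m: "switch_time D (k - 1) \<omega> \<le> t" "t < switch_time D (k - 1 + 1) \<omega>" using k by auto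
  have vel: "velocity v D t \<omega> = v k"
    using m phase_eqI[OF T m] k by (auto simp: velocity_phase simp del: One_nat_def)
  have zero: "?w j = 0" if "j \<in> {1..4} - {1..k}" for j
    using occupation_time_zero[OF T, of t k j] R that k by auto
  have "(\<Sum>j=1..k. ?w j *\<^sub>R v j) = (\<Sum>j=1..4. ?w j *\<^sub>R v j)" "sum ?w {1..k} = sum ?w {1..4}"
    using k zero by (intro sum.mono_neutral_left; force)+
  then have face: "(\<Sum>j=1..k. ?w j *\<^sub>R v j) = (\<Sum>j=1..4. ?w j *\<^sub>R v j)" "sum ?w {1..k} = t"
    using sum_occupation_time[OF t, of D \<omega>] by simp_all
  have pos_eq: "position c v D t \<omega> = c *\<^sub>R (\<Sum>j=1..k. ?w j *\<^sub>R v j)"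
    using R position_eq_occupation[of t D k \<omega> c v] face(1) by simp
  have "\<exists>x \<in> convex hull (v ` {1..k}). (\<Sum>j=1..k. ?w j *\<^sub>R v j) = t *\<^sub>R x"
  proof (cases "t = 0")
    \<comment> \<open>At time 0 the simplex degenerates to the origin, and there are no normalized weights.\<close>
    case True
    then have "?w j = 0" if "j \<in> {1..k}" for j
      using face(2) that by (simp add: sum_nonneg_eq_0_iff occupation_time_nonneg)
    moreover have "v 1 \<in> convex hull (v ` {1..k})" using k by (intro hull_inc) auto
    ultimately show ?thesis using True by auto
  next
    case False
    then have t: "t > 0" using t by simp
    let ?x = "\<Sum>j=1..k. (?w j / t) *\<^sub>R v j"
    have "(\<Sum>j=1..k. ?w j / t) = 1" using face(2) t by (simp flip: sum_divide_distrib)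
    then have "?x \<in> convex hull (v ` {1..k})"
      using t by (intro convex_sum) (auto simp: occupation_time_nonneg convex_convex_hull hull_inc)
    moreover have "(\<Sum>j=1..k. ?w j *\<^sub>R v j) = t *\<^sub>R ?x"
      using t by (simp add: scaleR_sum_right)
    ultimately show ?thesis by blast
  qed
  then have "position c v D t \<omega> \<in> convex hull (vertex c v t ` {1..k})"
    unfolding convex_hull_vertices pos_eq by auto
  then show ?L using vel by simp
qed

section \<open>The law of the durations\<close>

lemma emeasure_exponential_eq_0:
  assumes "B \<in> sets borel" "emeasure lborel (B \<inter> {0..}) = 0"
  shows "emeasure (density lborel (\<lambda>x. ennreal (exponential_density a x))) B = 0"
proof -
  have "AE x in lborel. x \<notin> B \<inter> {0..}"
    using assms by (intro AE_not_in null_setsI) auto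
  then have "AE x in lborel. ennreal (exponential_density a x) * indicator B x = 0"
    by eventually_elim (auto simp: exponential_density_def indicator_def)
  then have "(\<integral>\<^sup>+x. ennreal (exponential_density a x) * indicator B x \<partial>lborel) = 0"
    by (subst nn_integral_0_iff_AE) (use assms in auto)
  then show ?thesis using assms by (simp add: emeasure_density)
qed

text \<open>The null set \<open>B \<inter> {0..}\<close> has probability 0 under the exponential law of every rate, and so has \<open>B\<close>,
  because the density vanishes on the negative axis. So the conditional probability that
  \<open>W k\<close> falls in \<open>B\<close> vanishes, and its mean is the unconditional one. Half-lines of nonpositive
  numbers give positivity of the durations, singletons the absence of atoms.\<close>

lemma AE_interarrival_notin:
  assumes "prob_space M" "mixed_poisson_interarrivals M \<alpha> W" "k \<ge> 1"
    and B: "B \<in> sets borel" "emeasure lborel (B \<inter> {0..}) = 0"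
  shows "AE \<omega> in M. W k \<omega> \<notin> B"
proof -
  interpret prob_space M by fact
  let ?F = "vimage_algebra (space M) \<alpha> borel"
  let ?E = "{\<omega> \<in> space M. W k \<omega> \<in> B}"
  \<comment> \<open>The cylinder that constrains the \<open>k\<close>-th interarrival time only.\<close>
  let ?A = "\<lambda>i. if i = k then B else UNIV"
  have [measurable]: "\<alpha> \<in> borel_measurable M" "W k \<in> borel_measurable M" "B \<in> sets borel"
    using assms by (auto simp: mixed_poisson_interarrivals_def)
  have "subalgebra M ?F"
    by (auto simp: subalgebra_def sets_vimage_algebra2 measurable_sets)
  then interpret finite_measure_subalgebra M ?F
    by unfold_locales
  have E: "{\<omega> \<in> space M. \<forall>i\<in>{1..k}. W i \<omega> \<in> ?A i} = ?E"
    using \<open>k \<ge> 1\<close> by auto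
  have "(\<Prod>i=1..k. measure (density lborel (\<lambda>x. ennreal (exponential_density a x))) (?A i)) = 0" for a
    using \<open>k \<ge> 1\<close> B by (intro prod_zero bexI[of _ k]) (auto simp: measure_def emeasure_exponential_eq_0)
  moreover have "AE \<omega> in M.
      real_cond_exp M ?F (indicator {\<omega> \<in> space M. \<forall>i\<in>{1..k}. W i \<omega> \<in> ?A i}) \<omega> =
      (\<Prod>i=1..k. measure (density lborel (\<lambda>x. ennreal (exponential_density (\<alpha> \<omega>) x))) (?A i))"
    using assms(2)[unfolded mixed_poisson_interarrivals_def, THEN conjunct2, THEN conjunct2,
      THEN spec, THEN spec, of ?A k] B by simp
  ultimately have "AE \<omega> in M. real_cond_exp M ?F (indicator ?E) \<omega> = 0"
    by (simp only: E)
  then have "(\<integral>\<omega>. real_cond_exp M ?F (indicator ?E) \<omega> \<partial>M) = 0"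
    by (rule integral_eq_zero_AE)
  moreover have "integrable M (indicator ?E :: _ \<Rightarrow> real)"
    by (simp add: less_top[symmetric])
  ultimately have "(\<integral>\<omega>. indicator ?E \<omega> \<partial>M) = (0 :: real)"
    using real_cond_exp_int(2) by simp
  then have "prob ?E = 0" by simp
  then show ?thesis
    by (subst (asm) prob_eq_0) auto
qed

text \<open>By independence the joint law is a product, and for each fixed value \<open>y\<close> of \<open>Y\<close> the variable \<open>X\<close>
  avoids the single point \<open>t - y\<close>; Fubini does the rest.\<close>

lemma (in prob_space) AE_indep_add_neq:
  fixes X Y :: "'a \<Rightarrow> real"
  assumes "indep_var borel X borel Y" and atomless: "\<And>a. AE \<omega> in M. X \<omega> \<noteq> a"
  shows "AE \<omega> in M. X \<omega> + Y \<omega> \<noteq> t"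
proof -
  have [measurable]: "random_variable borel X" "random_variable borel Y"
    and eq: "distr M borel X \<Otimes>\<^sub>M distr M borel Y = distr M (borel \<Otimes>\<^sub>M borel) (\<lambda>\<omega>. (X \<omega>, Y \<omega>))"
    using assms(1) by (auto simp: indep_var_distribution_eq)
  interpret X: prob_space "distr M borel X" by (rule prob_space_distr) simp
  interpret Y: prob_space "distr M borel Y" by (rule prob_space_distr) simp
  interpret XY: pair_prob_space "distr M borel X" "distr M borel Y" ..
  have "AE x in distr M borel X. x + y \<noteq> t" for y
    using atomless[of "t - y"] by (subst AE_distr_iff) (auto simp: algebra_simps)
  moreover have "Measurable.pred (borel \<Otimes>\<^sub>M borel) (\<lambda>p::real \<times> real. fst p + snd p \<noteq> t)"
    by measurable
  then have S: "{p \<in> space (distr M borel X \<Otimes>\<^sub>M distr M borel Y). fst p + snd p \<noteq> t}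
      \<in> sets (distr M borel X \<Otimes>\<^sub>M distr M borel Y)"
    by (simp add: pred_def space_pair_measure cong: sets_pair_measure_cong)
  ultimately have "AE x in distr M borel X. AE y in distr M borel Y. x + y \<noteq> t"
    using XY.AE_commute[OF S] by simp
  then have "AE p in distr M borel X \<Otimes>\<^sub>M distr M borel Y. fst p + snd p \<noteq> t"
    using S by (intro XY.AE_pair_measure) auto
  then show ?thesis
    unfolding eq by (subst (asm) AE_distr_iff) auto
qed

section \<open>Measurability of the motion\<close>

lemma borel_measurable_switch_time:
  assumes "\<And>j k. j \<in> {1..4} \<Longrightarrow> k \<ge> 1 \<Longrightarrow> D j k \<in> borel_measurable M"
  shows "(\<lambda>\<omega>. switch_time D m \<omega>) \<in> borel_measurable M"
  unfolding switch_time_def total_duration_def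
  by (intro borel_measurable_add borel_measurable_sum assms)
     (auto intro: order_trans[OF _ less_imp_le[OF mod_less_divisor]])

lemma borel_measurable_velocity:
  assumes [measurable]: "\<And>m. (\<lambda>\<omega>. switch_time D m \<omega>) \<in> borel_measurable M"
  shows "(\<lambda>(\<omega>, s). velocity v D s \<omega>) \<in> borel_measurable (M \<Otimes>\<^sub>M borel)"
  unfolding velocity_def case_prod_beta by measurable

lemma borel_measurable_position:
  assumes "\<And>m. (\<lambda>\<omega>. switch_time D m \<omega>) \<in> borel_measurable M"
  shows "(\<lambda>\<omega>. position c v D t \<omega>) \<in> borel_measurable M"
proof -
  have [measurable]: "(\<lambda>(\<omega>, s). velocity v D s \<omega>) \<in> borel_measurable (M \<Otimes>\<^sub>M lborel)"
    using borel_measurable_velocity[OF assms] by simp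
  show ?thesis unfolding position_def set_lebesgue_integral_def by measurable
qed

section \<open>The probability of lying on a leading face\<close>

text \<open>The velocity 0, which stands for the absence of a current movement, must differ from all the
  directions.\<close>

lemma direction_neq_0: "direction \<theta> \<phi> j \<noteq> 0"
proof
  assume "direction \<theta> \<phi> j = 0"
  then have "cos (\<theta> j) * sin (\<phi> j) = 0" "sin (\<theta> j) * sin (\<phi> j) = 0" "cos (\<phi> j) = 0"
    unfolding direction_def by (metis vector_3 zero_index)+
  then show False
    using sin_cos_squared_add[of "\<phi> j"] sin_zero_abs_cos_one[of "\<theta> j"] by auto
qed

text \<open>Almost surely the path equivalence applies and the first movement has positive duration, so that
  the particle starts along \<open>v 1\<close>: the conditioning is on an event of probability 1. The events are
  shown measurable because an almost sure equivalence says nothing about the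
  measure of a nonmeasurable set.\<close>

lemma (in prob_space) cond_prob_leading_face:
  fixes v :: "nat \<Rightarrow> real ^ 3"
  assumes D: "\<And>j k. j \<in> {1..4} \<Longrightarrow> k \<ge> 1 \<Longrightarrow> D j k \<in> borel_measurable M"
    and pos: "\<And>j k. j \<in> {1..4} \<Longrightarrow> k \<ge> 1 \<Longrightarrow> AE \<omega> in M. D j k \<omega> > 0"
    and v: "inj_on v {1..4}" "\<not> affine_dependent (v ` {1..4})" "0 \<notin> v ` {1..4}"
    and c: "c > 0" and t: "t \<ge> 0" and k: "1 \<le> k" "k < 4"
  shows "\<P>(\<omega> in M. position c v D t \<omega> \<in> convex hull (vertex c v t ` {1..k}) \<and> velocity v D t \<omega> = v k
      \<bar> position c v D 0 \<omega> = 0 \<and> velocity v D 0 \<omega> = v 1)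
    = \<P>(\<omega> in M. switch_time D (k - 1) \<omega> \<le> t \<and> t < switch_time D k \<omega>)"
proof -
  have T [measurable]: "(\<lambda>\<omega>. switch_time D m \<omega>) \<in> borel_measurable M" for m
    using D by (rule borel_measurable_switch_time)
  have X [measurable]: "(\<lambda>\<omega>. position c v D s \<omega>) \<in> borel_measurable M" for s
    using T by (rule borel_measurable_position)
  have V [measurable]: "(\<lambda>\<omega>. velocity v D s \<omega>) \<in> borel_measurable M" for s
    unfolding velocity_def by measurable
  have [measurable]: "convex hull (vertex c v t ` {1..k}) \<in> sets borel"
    by (intro borel_closed compact_imp_closed finite_imp_compact_convex_hull) auto
  have "AE \<omega> in M. \<forall>k. \<forall>j\<in>{1..4}. k \<ge> 1 \<longrightarrow> D j k \<omega> > 0"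
    using pos by (auto simp: AE_all_countable AE_ball_countable)
  then have pos: "AE \<omega> in M. \<forall>j k. j \<in> {1..4} \<longrightarrow> k \<ge> 1 \<longrightarrow> D j k \<omega> > 0"
    by eventually_elim blast
  have "cond_prob M
        (\<lambda>\<omega>. position c v D t \<omega> \<in> convex hull (vertex c v t ` {1..k}) \<and> velocity v D t \<omega> = v k)
        (\<lambda>\<omega>. position c v D 0 \<omega> = 0 \<and> velocity v D 0 \<omega> = v 1)
      = cond_prob M (\<lambda>\<omega>. switch_time D (k - 1) \<omega> \<le> t \<and> t < switch_time D k \<omega>) (\<lambda>\<omega>. True)"
  proof (rule cond_prob_eq_AE)
    show "AE \<omega> in M. position c v D 0 \<omega> = 0 \<and> velocity v D 0 \<omega> = v 1 \<longrightarrow>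
        (position c v D t \<omega> \<in> convex hull (vertex c v t ` {1..k}) \<and> velocity v D t \<omega> = v k) =
        (switch_time D (k - 1) \<omega> \<le> t \<and> t < switch_time D k \<omega>)"
      using pos
    proof eventually_elim
      case (elim \<omega>)
      then show ?case using position_in_leading_face_iff[of D \<omega> v c t k] v c t k by blast
    qed
    show "AE \<omega> in M. (position c v D 0 \<omega> = 0 \<and> velocity v D 0 \<omega> = v 1) = True"
      using pos
    proof eventually_elim
      case (elim \<omega>)
      have "velocity v D 0 \<omega> = v 1"
        using elim switch_time_Suc[of D 0 \<omega>]
        by (intro velocity_eq[of D \<omega> 1 0]) (auto simp: switch_time_0)
      moreover have "position c v D 0 \<omega> = 0"
        unfolding position_def set_lebesgue_integral_def
        using AE_lborel_singleton[of "0::real"]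
        by (subst integral_eq_zero_AE) (auto elim: eventually_mono)
      ultimately show ?case by simp
    qed
  qed measurable
  then show ?thesis by (simp add: cond_prob_def prob_space)
qed

theorem theorem1:
  fixes M :: "'w measure"
    and \<theta> \<phi> :: "nat \<Rightarrow> real"
    and c t :: real
    and l :: "nat \<Rightarrow> real"
    and D :: "nat \<Rightarrow> nat \<Rightarrow> 'w \<Rightarrow> real"
  assumes "prob_space M"
    and "\<And>j. j \<in> {1..4} \<Longrightarrow> \<theta> j \<in> {0..2 * pi}"
    and "\<And>j. j \<in> {1..4} \<Longrightarrow> \<phi> j \<in> {0..pi}"
    and "inj_on (direction \<theta> \<phi>) {1..4}"
    and "\<not> affine_dependent (direction \<theta> \<phi> ` {1..4})"
    and "c > 0"
    and "\<And>j. j \<in> {1..4} \<Longrightarrow> l j > 0"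
    and "\<And>j. j \<in> {1..4} \<Longrightarrow> gcp_interarrivals M (l j) (D j)"
    and "prob_space.indep_vars M (\<lambda>_. PiM {1..} (\<lambda>_. borel)) (\<lambda>j \<omega>. \<lambda>k\<in>{1..}. D j k \<omega>) {1..4}"
    and "t \<ge> 0"
  shows
    "\<P>(\<omega> in M.
        position c (direction \<theta> \<phi>) D t \<omega> =
          vector [c * t * cos (\<theta> 1) * sin (\<phi> 1), c * t * sin (\<theta> 1) * sin (\<phi> 1), c * t * cos (\<phi> 1)] \<and>
        velocity (direction \<theta> \<phi>) D t \<omega> = direction \<theta> \<phi> 1
        \<bar> position c (direction \<theta> \<phi>) D 0 \<omega> = 0 \<and> velocity (direction \<theta> \<phi>) D 0 \<omega> = direction \<theta> \<phi> 1)
      = \<P>(\<omega> in M. D 1 1 \<omega> > t) \<and>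
     \<P>(\<omega> in M.
        position c (direction \<theta> \<phi>) D t \<omega> \<in> edge12 c (direction \<theta> \<phi>) t \<and>
        velocity (direction \<theta> \<phi>) D t \<omega> = direction \<theta> \<phi> 2
        \<bar> position c (direction \<theta> \<phi>) D 0 \<omega> = 0 \<and> velocity (direction \<theta> \<phi>) D 0 \<omega> = direction \<theta> \<phi> 1)
      = \<P>(\<omega> in M. D 1 1 \<omega> < t \<and> t \<le> D 1 1 \<omega> + D 2 1 \<omega>) \<and>
     \<P>(\<omega> in M.
        position c (direction \<theta> \<phi>) D t \<omega> \<in> face123 c (direction \<theta> \<phi>) t \<and>
        velocity (direction \<theta> \<phi>) D t \<omega> = direction \<theta> \<phi> 3
        \<bar> position c (direction \<theta> \<phi>) D 0 \<omega> = 0 \<and> velocity (direction \<theta> \<phi>) D 0 \<omega> = direction \<theta> \<phi> 1)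
      = \<P>(\<omega> in M. D 1 1 \<omega> + D 2 1 \<omega> < t \<and> t \<le> D 1 1 \<omega> + D 2 1 \<omega> + D 3 1 \<omega>)"
proof -
  interpret prob_space M by fact
  let ?v = "direction \<theta> \<phi>"
  have AE_notin: "AE \<omega> in M. D j k \<omega> \<notin> B"
    if "j \<in> {1..4}" "k \<ge> 1" "B \<in> sets borel" "emeasure lborel (B \<inter> {0..}) = 0" for j k B
    using assms(8)[OF that(1)] AE_interarrival_notin[OF assms(1) _ that(2-4)]
    unfolding gcp_interarrivals_def by blast
  have D: "D j k \<in> borel_measurable M" if "j \<in> {1..4}" "k \<ge> 1" for j k
    using assms(8)[OF that(1)] that(2)
    by (auto simp: gcp_interarrivals_def mixed_poisson_interarrivals_def)
  have pos: "AE \<omega> in M. D j k \<omega> > 0" if "j \<in> {1..4}" "k \<ge> 1" for j k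
  proof -
    have "{..0::real} \<inter> {0..} = {0}" by auto
    then show ?thesis using AE_notin[OF that, of "{..0}"] by (simp add: not_le)
  qed
  have atomless: "AE \<omega> in M. D j 1 \<omega> \<noteq> a" if "j \<in> {1..4}" for j a
    using AE_notin[OF that, of 1 "{a}"] by (cases "a \<ge> 0") auto
  have "indep_vars (\<lambda>_. borel) (\<lambda>j \<omega>. (\<lambda>f. f 1) (\<lambda>k\<in>{1..}. D j k \<omega>)) {1..4}"
    by (rule indep_vars_compose2[OF assms(9)]) (auto intro: measurable_component_singleton)
  then have indep: "indep_vars (\<lambda>_. borel) (\<lambda>j. D j 1) {1..4}"
    by simp
  \<comment> \<open>The partial sums of first durations have no atoms: split off one independent summand.\<close>
  have first_neq: "AE \<omega> in M. D j 1 \<omega> + (\<Sum>i\<in>I. D i 1 \<omega>) \<noteq> t"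
    if "insert j I \<subseteq> {1..4}" "j \<notin> I" for j I
  proof (rule AE_indep_add_neq)
    show "indep_var borel (D j 1) borel (\<lambda>\<omega>. \<Sum>i\<in>I. D i 1 \<omega>)"
      using that finite_subset[of I "{1..4}"]
      by (intro indep_vars_sum[of I j "\<lambda>j. D j 1"] indep_vars_subset[OF indep]) auto
  qed (use that atomless in auto)
  have T: "switch_time D 1 \<omega> = D 1 1 \<omega>" "switch_time D 2 \<omega> = D 1 1 \<omega> + D 2 1 \<omega>"
      "switch_time D 3 \<omega> = D 1 1 \<omega> + D 2 1 \<omega> + D 3 1 \<omega>" for \<omega>
    using switch_time_Suc[of D 0 \<omega>] switch_time_Suc[of D 1 \<omega>] switch_time_Suc[of D 2 \<omega>]
    by (simp_all add: switch_time_0 numeral_2_eq_2 numeral_3_eq_3)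
  have neq1: "AE \<omega> in M. D 1 1 \<omega> \<noteq> t" using atomless by simp
  have neq2: "AE \<omega> in M. D 1 1 \<omega> + D 2 1 \<omega> \<noteq> t" using first_neq[of 1 "{2}"] by simp
  have neq3: "AE \<omega> in M. D 1 1 \<omega> + D 2 1 \<omega> + D 3 1 \<omega> \<noteq> t"
    using first_neq[of 3 "{1, 2}"] by (simp add: algebra_simps)
  have D_meas: "D 1 1 \<in> borel_measurable M" "D 2 1 \<in> borel_measurable M"
      "D 3 1 \<in> borel_measurable M"
    by (auto intro!: D simp del: One_nat_def)
  \<comment> \<open>The second form has the index 1 as a successor, which is how the simplifier leaves it.\<close>
  note [measurable] = D_meas D_meas[simplified]
  have v0: "0 \<notin> ?v ` {1..4}" using direction_neq_0 by (metis imageE)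
  note face = cond_prob_leading_face[of D ?v c t, OF _ _ assms(4,5) v0 assms(6,10)]
  note face = face[OF D pos]
  have hull1: "x \<in> convex hull (vertex c ?v t ` {1..1}) \<longleftrightarrow>
      x = vector [c * t * cos (\<theta> 1) * sin (\<phi> 1), c * t * sin (\<theta> 1) * sin (\<phi> 1), c * t * cos (\<phi> 1)]" for x
    by (simp add: vertex_def direction_def vec_eq_iff forall_3 vector_3 mult.assoc)
  have hull2: "convex hull (vertex c ?v t ` {1..2}) = edge12 c ?v t"
  proof -
    have "{1..2::nat} = {1, 2}" by auto
    then show ?thesis by (simp add: edge12_def segment_convex_hull)
  qed
  have hull3: "convex hull (vertex c ?v t ` {1..3}) = face123 c ?v t"
  proof -
    have "{1..3::nat} = {1, 2, 3}" by auto
    then show ?thesis by (simp add: face123_def)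
  qed
  have 1: "\<P>(\<omega> in M. switch_time D (1 - 1) \<omega> \<le> t \<and> t < switch_time D 1 \<omega>) = \<P>(\<omega> in M. D 1 1 \<omega> > t)"
    using assms(10) by (simp add: T[simplified] switch_time_0)
  \<comment> \<open>The intervals are half-open on opposite sides; the endpoints are hit with probability 0.\<close>
  have 2: "\<P>(\<omega> in M. switch_time D (2 - 1) \<omega> \<le> t \<and> t < switch_time D 2 \<omega>)
      = \<P>(\<omega> in M. D 1 1 \<omega> < t \<and> t \<le> D 1 1 \<omega> + D 2 1 \<omega>)"
  proof (rule prob_eq_AE)
    show "AE \<omega> in M. (switch_time D (2 - 1) \<omega> \<le> t \<and> t < switch_time D 2 \<omega>)
        = (D 1 1 \<omega> < t \<and> t \<le> D 1 1 \<omega> + D 2 1 \<omega>)"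
      using neq1 neq2 by eventually_elim (auto simp: T[simplified])
  qed (simp_all add: T[simplified], measurable)
  have 3: "\<P>(\<omega> in M. switch_time D (3 - 1) \<omega> \<le> t \<and> t < switch_time D 3 \<omega>)
      = \<P>(\<omega> in M. D 1 1 \<omega> + D 2 1 \<omega> < t \<and> t \<le> D 1 1 \<omega> + D 2 1 \<omega> + D 3 1 \<omega>)"
  proof (rule prob_eq_AE)
    show "AE \<omega> in M. (switch_time D (3 - 1) \<omega> \<le> t \<and> t < switch_time D 3 \<omega>)
        = (D 1 1 \<omega> + D 2 1 \<omega> < t \<and> t \<le> D 1 1 \<omega> + D 2 1 \<omega> + D 3 1 \<omega>)"
      using neq2 neq3 by eventually_elim (auto simp: T[simplified])
  qed (simp_all add: T[simplified], measurable)
  from face[of 1] face[of 2] face[of 3] show ?thesis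
    unfolding hull1 hull2 hull3 1 2 3 by simp
qed

end
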